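(* Let $G$ be a finite simple graph with $|G|$ vertices. Then \[ \hat Z(G) = |G| - \min\{ \operatorname{tri}(\mathcal A) : \mathcal A \in \mathcal{S}_{\mathrm{znz}}(G) \}. \]
   Context: A zero-nonzero pattern is a matrix with entries in $\{0,*\}$. A square pattern is a triangle if some permutation of its rows followed by some independent permutation of its columns yields a lower-triangular pattern with only $*$ entries on its diagonal. The triangle number $\operatorname{tri}(\mathcal{Y})$ of a pattern $\mathcal{Y}$ is the largest size of a square submatrix of $\mathcal{Y}$ that is a triangle. For a simple graph $G$ with vertex set $V(G)$, $\mathcal{S}_{\mathrm{znz}}(G)$ is the set of the $2^{|G|}$ symmetric $V(G)\times V(G)$ zero-nonzero patterns whose off-diagonal $(i,j)$ entry is $*$ exactly when $\{i,j\}$ is an edge of $G$ and whose diagonal entries are arbitrary. A looping of $G$ is a loop graph obtained from $G$ by adding loops at some of its vertices. In a loop graph with some vertices filled, the loop zero forcing rule says: a vertex $v$ (filled or not) may force (fill) a vertex $u$ if $u$ is the only unfilled neighbor of $v$ (a vertex with a loop is its own neighbor). A loop zero forcing set is a set of initially filled vertices from which repeated application of this rule fills every vertex; the zero forcing number of a loop graph is the smallest size of a loop zero forcing set. The enhanced zero forcing number $\hat Z(G)$ is the maximum, over all loopings $\hat G$ of $G$, of the zero forcing number of $\hat G$. *)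

theory Defs
  imports
    "HOL-Library.FuncSet"
    "Graph_Theory.Pair_Digraph"
begin

text \<open>Finite simple graphs are the \<^locale>\<open>pair_graph\<close>s: an edge \<open>{u, v}\<close> is the pair of
  arcs \<open>(u, v)\<close> and \<open>(v, u)\<close>. Loop graphs are the \<^locale>\<open>pair_pseudo_graph\<close>s: a loop at
  \<open>v\<close> is the arc \<open>(v, v)\<close>.\<close>

section \<open>Zero-nonzero patterns\<close>

datatype znz = Zero | Star

text \<open>A pattern with row index set \<open>R\<close> and column index set \<open>C\<close> is a function in
  \<open>R \<times> C \<rightarrow>\<^sub>E UNIV\<close>. Submatrices are given by subsets of the index sets.\<close>

definition lower_triangular :: "nat \<Rightarrow> (nat \<Rightarrow> nat \<Rightarrow> znz) \<Rightarrow> bool" where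
  "lower_triangular n B \<longleftrightarrow> (\<forall>i<n. \<forall>j<n. i < j \<longrightarrow> B i j = Zero)"

text \<open>The index sets carry no order, so permuting the rows and, independently, the columns
  amounts to choosing enumerations \<open>r\<close> of \<open>R\<close> and \<open>c\<close> of \<open>C\<close>. That both range over
  \<open>{..<n}\<close> makes the submatrix square. The empty pattern is a triangle of size \<open>0\<close>.\<close>

definition is_triangle :: "'r set \<Rightarrow> 'c set \<Rightarrow> ('r \<times> 'c \<Rightarrow> znz) \<Rightarrow> bool" where
  "is_triangle R C A \<longleftrightarrow>
     (\<exists>n r c. bij_betw r {..<n} R \<and> bij_betw c {..<n} C \<and>
        lower_triangular n (\<lambda>i j. A (r i, c j)) \<and>
        (\<forall>i<n. A (r i, c i) = Star))"

definition tri :: "'r set \<Rightarrow> 'c set \<Rightarrow> ('r \<times> 'c \<Rightarrow> znz) \<Rightarrow> nat" where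
  "tri R C A = Max {card R' | R' C'. R' \<subseteq> R \<and> C' \<subseteq> C \<and> is_triangle R' C' A}"

definition S_znz :: "'a pair_pre_digraph \<Rightarrow> ('a \<times> 'a \<Rightarrow> znz) set" where
  "S_znz G = {A \<in> pverts G \<times> pverts G \<rightarrow>\<^sub>E UNIV.
     (\<forall>i\<in>pverts G. \<forall>j\<in>pverts G. A (i, j) = A (j, i)) \<and>
     (\<forall>i\<in>pverts G. \<forall>j\<in>pverts G. i \<noteq> j \<longrightarrow> (A (i, j) = Star \<longleftrightarrow> (i, j) \<in> parcs G))}"

section \<open>Loop zero forcing\<close>

definition loopings :: "'a pair_pre_digraph \<Rightarrow> 'a pair_pre_digraph set" where
  "loopings G = {G\<lparr>parcs := parcs G \<union> Id_on L\<rparr> | L. L \<subseteq> pverts G}"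

definition neighbors :: "'a pair_pre_digraph \<Rightarrow> 'a \<Rightarrow> 'a set" where
  "neighbors H v = {u. (v, u) \<in> parcs H}"

definition loop_force :: "'a pair_pre_digraph \<Rightarrow> 'a set \<Rightarrow> 'a set \<Rightarrow> bool" where
  "loop_force H F F' \<longleftrightarrow>
     (\<exists>v\<in>pverts H. \<exists>u. neighbors H v - F = {u} \<and> F' = insert u F)"

definition loop_zero_forcing_set :: "'a pair_pre_digraph \<Rightarrow> 'a set \<Rightarrow> bool" where
  "loop_zero_forcing_set H F \<longleftrightarrow> F \<subseteq> pverts H \<and> (loop_force H)\<^sup>*\<^sup>* F (pverts H)"

definition loop_zero_forcing_number :: "'a pair_pre_digraph \<Rightarrow> nat" where
  "loop_zero_forcing_number H = Min {card F | F. loop_zero_forcing_set H F}"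

definition Zhat :: "'a pair_pre_digraph \<Rightarrow> nat" where
  "Zhat G = Max (loop_zero_forcing_number ` loopings G)"

section \<open>Well-definedness of the maxima and minima\<close>

lemma tri_set_finite_nonempty:
  assumes "finite R"
  shows "finite {card R' | R' C'. R' \<subseteq> R \<and> C' \<subseteq> C \<and> is_triangle R' C' A}" (is "finite ?S")
    and "{card R' | R' C'. R' \<subseteq> R \<and> C' \<subseteq> C \<and> is_triangle R' C' A} \<noteq> {}"
proof -
  have "?S \<subseteq> card ` Pow R" by auto
  then show "finite ?S" using assms by (meson finite_Pow_iff finite_imageI finite_subset)
  have "is_triangle {} {} A"
    unfolding is_triangle_def lower_triangular_def
    by (rule exI[of _ 0]) (auto simp: bij_betw_def)
  then show "?S \<noteq> {}" by blast
qed

lemma looping_pair_pseudo_graph: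
  assumes "pair_graph G" "H \<in> loopings G"
  shows "pair_pseudo_graph H" "pverts H = pverts G"
proof -
  interpret pair_graph G by fact
  obtain L where L: "L \<subseteq> pverts G" "H = G\<lparr>parcs := parcs G \<union> Id_on L\<rparr>"
    using assms(2) by (auto simp: loopings_def)
  have "finite L" using L(1) by (meson finite_subset pair_finite_verts)
  moreover have "Id_on L = (\<lambda>v. (v, v)) ` L" by auto
  moreover have "sym (parcs G \<union> Id_on L)"
    using pair_sym_arcs by (intro sym_Un sym_Id_on) (simp add: symmetric_def)
  ultimately show "pair_pseudo_graph H"
    using L by unfold_locales (auto simp: symmetric_def in_arcsD1 in_arcsD2)
  show "pverts H = pverts G" using L by simp
qed

lemma loop_zero_forcing_sets_finite_nonempty:
  assumes "finite (pverts H)"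
  shows "finite {card F | F. loop_zero_forcing_set H F}" (is "finite ?S")
    and "{card F | F. loop_zero_forcing_set H F} \<noteq> {}"
proof -
  have "?S \<subseteq> card ` Pow (pverts H)" by (auto simp: loop_zero_forcing_set_def)
  then show "finite ?S" using assms by (meson finite_Pow_iff finite_imageI finite_subset)
  have "loop_zero_forcing_set H (pverts H)" by (simp add: loop_zero_forcing_set_def)
  then show "?S \<noteq> {}" by blast
qed

lemma loopings_finite_nonempty:
  assumes "finite (pverts G)"
  shows "finite (loopings G)" "loopings G \<noteq> {}"
proof -
  have "loopings G = (\<lambda>L. G\<lparr>parcs := parcs G \<union> Id_on L\<rparr>) ` Pow (pverts G)"
    by (auto simp: loopings_def)
  then show "finite (loopings G)" "loopings G \<noteq> {}" using assms by auto
qed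

lemma card_S_znz:
  fixes G :: "'a pair_pre_digraph"
  assumes "pair_graph G"
  shows "card (S_znz G) = 2 ^ card (pverts G)"
proof -
  interpret pair_graph G by fact
  define V where "V = pverts G"
  define pat where "pat L = (\<lambda>x. if x \<in> V \<times> V then
      (if x \<in> parcs G \<or> (fst x = snd x \<and> fst x \<in> L) then Star else Zero) else undefined)" for L
  have nl: "(i, i) \<notin> parcs G" for i using pair_no_loops by fastforce
  have sy: "(i, j) \<in> parcs G \<longleftrightarrow> (j, i) \<in> parcs G" for i j
    using pair_sym_arcs by (auto simp: symmetric_def dest: symD)
  have "bij_betw pat (Pow V) (S_znz G)"
  proof (rule bij_betwI[where g = "\<lambda>A. {v \<in> V. A (v, v) = Star}"])
    show "pat \<in> Pow V \<rightarrow> S_znz G"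
      using sy by (auto simp: pat_def S_znz_def V_def split: if_splits)
    show "(\<lambda>A. {v \<in> V. A (v, v) = Star}) \<in> S_znz G \<rightarrow> Pow V" by auto
    show "{v \<in> V. pat L (v, v) = Star} = L" if "L \<in> Pow V" for L
      using that nl by (auto simp: pat_def split: if_splits)
    show "pat {v \<in> V. A (v, v) = Star} = A" if "A \<in> S_znz G" for A
    proof
      fix x :: "'a \<times> 'a"
      obtain i j where x: "x = (i, j)" by (cases x)
      show "pat {v \<in> V. A (v, v) = Star} x = A x"
      proof (cases "x \<in> V \<times> V")
        case False
        then show ?thesis using that x by (auto simp: pat_def S_znz_def V_def PiE_def extensional_def)
      next
        case True
        then have V: "i \<in> V" "j \<in> V" using x by auto
        have off: "i \<noteq> j \<Longrightarrow> A (i, j) = Star \<longleftrightarrow> (i, j) \<in> parcs G"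
          using that V by (simp add: S_znz_def V_def)
        show ?thesis
          by (cases "A (i, j)"; cases "i = j") (use V off nl in \<open>simp_all add: x pat_def\<close>)
      qed
    qed
  qed
  then show ?thesis
    using card_Pow[OF pair_finite_verts] by (simp add: V_def bij_betw_same_card[symmetric])
qed

end

theory Submission
  imports Defs
begin

text \<open>The successive forces \<open>v\<^sub>1 \<rightarrow> u\<^sub>1, \<dots>, v\<^sub>k \<rightarrow> u\<^sub>k\<close> that fill a loop graph from \<open>F\<close> are
  the diagonal entries of a triangle in its pattern: when \<open>v\<^sub>i\<close> forces \<open>u\<^sub>i\<close>, the vertices
  \<open>u\<^sub>j\<close> with \<open>j > i\<close> are still unfilled, so they are not neighbors of \<open>v\<^sub>i\<close>. Conversely, the
  diagonal of a triangle with column set \<open>C\<close> is a sequence of forces starting from the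
  complement of \<open>C\<close>. So the zero forcing number of a loop graph is its order minus the triangle
  number of its pattern, and the patterns of the loopings of \<open>G\<close> are exactly \<open>S_znz G\<close>.\<close>

text \<open>The \<open>restrict\<close> leaves \<open>undefined\<close> outside the index square, as
  in the extensional functions of \<open>S_znz\<close>, so that the two kinds of patterns can be
  equal as functions.\<close>

definition pattern_of :: "'a pair_pre_digraph \<Rightarrow> 'a \<times> 'a \<Rightarrow> znz" where
  "pattern_of H = restrict (\<lambda>x. if x \<in> parcs H then Star else Zero) (pverts H \<times> pverts H)"

lemma pattern_of_eq [simp]:
  assumes "v \<in> pverts H" "u \<in> pverts H"
  shows "pattern_of H (v, u) = Star \<longleftrightarrow> (v, u) \<in> parcs H"
    and "pattern_of H (v, u) = Zero \<longleftrightarrow> (v, u) \<notin> parcs H"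
  using assms by (auto simp: pattern_of_def)

lemma is_triangle_card:
  assumes "is_triangle R C A"
  shows "card R = card C"
  using assms unfolding is_triangle_def by (metis bij_betw_same_card)

text \<open>The new row and column go in front. The first row of a lower-triangular pattern must
  vanish to the right of the diagonal, which is the last hypothesis; the entries below the new
  diagonal entry are arbitrary.\<close>

lemma is_triangle_insert:
  assumes "is_triangle R C A" "A (v, u) = Star" "\<forall>w\<in>C. A (v, w) = Zero"
  shows "is_triangle (insert v R) (insert u C) A"
proof -
  obtain n :: nat and r c where r: "bij_betw r {..<n} R" and c: "bij_betw c {..<n} C"
    and low: "\<forall>i<n. \<forall>j<n. i < j \<longrightarrow> A (r i, c j) = Zero"
    and diag: "\<forall>i<n. A (r i, c i) = Star"
    using assms(1) unfolding is_triangle_def lower_triangular_def by blast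
  have rR: "R = r ` {..<n}" and cC: "C = c ` {..<n}"
    using r c by (auto simp: bij_betw_def)
  have u: "u \<notin> C" using assms(2,3) by auto
  \<comment> \<open>Each row of \<open>R\<close> has a \<open>Star\<close> in some column of
    \<open>C\<close>, but row \<open>v\<close> has none.\<close>
  have v: "v \<notin> R" using assms(3) diag cC rR by fastforce
  \<comment> \<open>\<open>case_nat x f\<close> puts \<open>x\<close> at index 0 and shifts the
    enumeration \<open>f\<close> by one.\<close>
  have bij: "bij_betw (case_nat x f) {..<Suc n} (insert x X)"
    if "bij_betw f {..<n} X" "x \<notin> X" for x f and X :: "'z set"
  proof -
    have "bij_betw (case_nat x f) (Suc ` {..<n}) X"
      using that(1) by (auto simp: bij_betw_def inj_on_def image_image)
    then show ?thesis
      using that(2) notIn_Un_bij_betw[of 0 "Suc ` {..<n}" "case_nat x f" X]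
      by (simp add: lessThan_Suc_eq_insert_0)
  qed
  have "lower_triangular (Suc n) (\<lambda>i j. A (case_nat v r i, case_nat u c j))"
    unfolding lower_triangular_def
    using low assms(3) cC by (auto split: nat.split)
  moreover have "\<forall>i<Suc n. A (case_nat v r i, case_nat u c i) = Star"
    using diag assms(2) by (auto split: nat.split)
  ultimately show ?thesis
    unfolding is_triangle_def using bij[OF r v] bij[OF c u] by blast
qed

context pair_fin_digraph
begin

text \<open>Induction peels off the first force, so the triangle grows from the last force
  backwards: \<open>R\<close> collects the forcing vertices, and each earlier force is put on
  top.\<close>

lemma forcing_imp_triangle:
  assumes "(loop_force G)\<^sup>*\<^sup>* F (pverts G)" "F \<subseteq> pverts G"
  shows "\<exists>R\<subseteq>pverts G. is_triangle R (pverts G - F) (pattern_of G)"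
  using assms
proof (induction rule: converse_rtranclp_induct)
  case base
  have "is_triangle {} {} (pattern_of G)"
    unfolding is_triangle_def lower_triangular_def
    by (rule exI[of _ 0]) (auto simp: bij_betw_def)
  then show ?case by auto
next
  case (step F F')
  obtain v u where v: "v \<in> pverts G" and nb: "neighbors G v - F = {u}"
    and F': "F' = insert u F"
    using step.hyps(1) by (auto simp: loop_force_def)
  have vu: "(v, u) \<in> parcs G" "u \<notin> F" using nb by (auto simp: neighbors_def)
  then have u: "u \<in> pverts G" using in_arcsD2 by auto
  obtain R where R: "R \<subseteq> pverts G" "is_triangle R (pverts G - F') (pattern_of G)"
    using step.IH step.prems u F' by auto
  \<comment> \<open>Once \<open>v\<close> has forced \<open>u\<close>, all its neighbors are
    filled.\<close>
  have "\<forall>w\<in>pverts G - F'. pattern_of G (v, w) = Zero"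
    using nb v F' by (auto simp: neighbors_def)
  from is_triangle_insert[OF R(2) _ this, of u]
  have "is_triangle (insert v R) (insert u (pverts G - F')) (pattern_of G)"
    using u v vu by simp
  moreover have "insert u (pverts G - F') = pverts G - F" using u vu F' by auto
  ultimately show ?case using R(1) v by (intro exI[of _ "insert v R"]) simp
qed

lemma triangle_imp_forcing:
  assumes "is_triangle R C (pattern_of G)" "R \<subseteq> pverts G" "C \<subseteq> pverts G"
  shows "(loop_force G)\<^sup>*\<^sup>* (pverts G - C) (pverts G)"
proof -
  obtain n :: nat and r c where r: "bij_betw r {..<n} R" and c: "bij_betw c {..<n} C"
    and low: "\<forall>i<n. \<forall>j<n. i < j \<longrightarrow> pattern_of G (r i, c j) = Zero"
    and diag: "\<forall>i<n. pattern_of G (r i, c i) = Star"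
    using assms(1) unfolding is_triangle_def lower_triangular_def by blast
  have rV: "r i \<in> pverts G" and cV: "c i \<in> pverts G" if "i < n" for i
    using that r c assms(2,3) by (auto simp: bij_betw_def)
  \<comment> \<open>After \<open>i\<close> forces, the unfilled vertices are \<open>c i\<close>,
    ..., \<open>c (n - 1)\<close>; next, \<open>r i\<close> forces \<open>c i\<close>.\<close>
  have "(loop_force G)\<^sup>*\<^sup>* (pverts G - C) (pverts G - c ` {i..<n})" if "i \<le> n" for i
    using that
  proof (induction i)
    case 0
    then show ?case using c by (simp add: bij_betw_def lessThan_atLeast0)
  next
    case (Suc i)
    have eq: "{i..<n} = insert i {Suc i..<n}" using Suc.prems by auto
    have fresh: "c i \<notin> c ` {Suc i..<n}"
    proof
      assume "c i \<in> c ` {Suc i..<n}"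
      then obtain j where "c i = c j" "i < j" "j < n" by auto
      then show False using bij_betw_imp_inj_on[OF c] inj_onD[of c "{..<n}" i j] by simp
    qed
    \<comment> \<open>An unfilled neighbor of \<open>r i\<close> is some \<open>c j\<close> with
      \<open>j\<close> at least \<open>i\<close>, and a \<open>Star\<close> with
      \<open>j > i\<close> would lie above the diagonal.\<close>
    have "w = c i" if "(r i, w) \<in> parcs G" "w \<notin> pverts G - c ` {i..<n}" for w
    proof -
      have "w \<in> c ` {i..<n}" using that in_arcsD2 by auto
      then obtain j where j: "w = c j" "i \<le> j" "j < n" by auto
      have "pattern_of G (r i, c j) = Star" using rV[of i] cV[of j] that(1) j by auto
      then have "\<not> i < j" using low j by (metis less_trans znz.distinct(1))
      then show ?thesis using j by simp
    qed
    moreover have "(r i, c i) \<in> parcs G" using diag rV cV Suc.prems by force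
    moreover have "c i \<in> c ` {i..<n}" using Suc.prems by simp
    ultimately have "neighbors G (r i) - (pverts G - c ` {i..<n}) = {c i}"
      unfolding neighbors_def by blast
    moreover have "pverts G - c ` {Suc i..<n} = insert (c i) (pverts G - c ` {i..<n})"
      using fresh cV[of i] Suc.prems unfolding eq by auto
    ultimately have "loop_force G (pverts G - c ` {i..<n}) (pverts G - c ` {Suc i..<n})"
      unfolding loop_force_def using rV[of i] Suc.prems by auto
    then show ?case using Suc.IH Suc.prems by (simp add: rtranclp.rtrancl_into_rtrancl)
  qed
  from this[of n] show ?thesis by simp
qed

lemma loop_zero_forcing_number_eq:
  "loop_zero_forcing_number G = card (pverts G) - tri (pverts G) (pverts G) (pattern_of G)"
proof -
  let ?V = "pverts G"
  note Z = loop_zero_forcing_sets_finite_nonempty[OF pair_finite_verts]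
  note T = tri_set_finite_nonempty[OF pair_finite_verts, of ?V "pattern_of G"]
  show ?thesis
  proof (rule antisym)
    obtain R C where RC: "tri ?V ?V (pattern_of G) = card R" "R \<subseteq> ?V" "C \<subseteq> ?V"
      "is_triangle R C (pattern_of G)"
      using Max_in[OF T] unfolding tri_def by auto
    have "loop_zero_forcing_set G (?V - C)"
      unfolding loop_zero_forcing_set_def using triangle_imp_forcing RC by auto
    then have "loop_zero_forcing_number G \<le> card (?V - C)"
      unfolding loop_zero_forcing_number_def by (intro Min_le[OF Z(1)]) auto
    then show "loop_zero_forcing_number G \<le> card ?V - tri ?V ?V (pattern_of G)"
      using RC is_triangle_card[OF RC(4)] by (simp add: card_Diff_subset finite_subset)
  next
    obtain F where F: "loop_zero_forcing_number G = card F" "loop_zero_forcing_set G F"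
      using Min_in[OF Z] unfolding loop_zero_forcing_number_def by auto
    then have sub: "F \<subseteq> ?V" by (simp add: loop_zero_forcing_set_def)
    obtain R where R: "R \<subseteq> ?V" "is_triangle R (?V - F) (pattern_of G)"
      using F forcing_imp_triangle[of F] by (auto simp: loop_zero_forcing_set_def)
    have "card R \<le> tri ?V ?V (pattern_of G)"
      unfolding tri_def using R by (intro Max_ge[OF T(1)]) blast
    moreover have "card R = card ?V - card F"
      using is_triangle_card[OF R(2)] sub by (simp add: card_Diff_subset finite_subset)
    ultimately show "card ?V - tri ?V ?V (pattern_of G) \<le> loop_zero_forcing_number G"
      using F(1) by simp
  qed
qed

end

text \<open>Guarantees that subtracting a triangle number from the order is not truncated, as needed
  to pass from naturals to integers.\<close>

lemma tri_le_card:
  assumes "finite R"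
  shows "tri R C A \<le> card R"
  unfolding tri_def
  using tri_set_finite_nonempty[OF assms, of C A] assms
  by (subst Max_le_iff) (auto intro: card_mono)

lemma S_znz_eq_patterns_of_loopings:
  assumes "pair_graph G"
  shows "S_znz G = pattern_of ` loopings G"
proof
  interpret pair_graph G by fact
  have nl: "(i, i) \<notin> parcs G" for i using pair_no_loops by fastforce
  have sy: "(i, j) \<in> parcs G \<longleftrightarrow> (j, i) \<in> parcs G" for i j
    using pair_sym_arcs by (auto simp: symmetric_def dest: symD)
  show "pattern_of ` loopings G \<subseteq> S_znz G"
    using sy by (auto simp: loopings_def pattern_of_def S_znz_def PiE_iff split: if_splits)
  show "S_znz G \<subseteq> pattern_of ` loopings G"
  proof
    fix A assume A: "A \<in> S_znz G"
    \<comment> \<open>The diagonal stars of \<open>A\<close> become the loops; the other entries are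
      already fixed by \<open>G\<close>.\<close>
    define L where "L = {v \<in> pverts G. A (v, v) = Star}"
    define H where "H = G\<lparr>parcs := parcs G \<union> Id_on L\<rparr>"
    have "A = pattern_of H"
    proof (rule extensionalityI[where A = "pverts G \<times> pverts G"])
      show "A \<in> extensional (pverts G \<times> pverts G)"
        using A by (auto simp: S_znz_def PiE_def)
      show "pattern_of H \<in> extensional (pverts G \<times> pverts G)"
        by (simp add: pattern_of_def H_def)
      fix x assume "x \<in> pverts G \<times> pverts G"
      then obtain i j where x: "x = (i, j)" "i \<in> pverts G" "j \<in> pverts G" by auto
      have "i \<noteq> j \<Longrightarrow> A (i, j) = Star \<longleftrightarrow> (i, j) \<in> parcs G"
        using A x by (simp add: S_znz_def)
      then show "A x = pattern_of H x"
        using x nl by (cases "A (i, j)"; cases "i = j") (auto simp: pattern_of_def H_def L_def)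
    qed
    moreover have "H \<in> loopings G" by (auto simp: loopings_def H_def L_def)
    ultimately show "A \<in> pattern_of ` loopings G" by blast
  qed
qed

theorem theorem2p2:
  fixes G :: "'a pair_pre_digraph"
  assumes "pair_graph G"
  shows "int (Zhat G) =
    int (card (pverts G)) - int (Min (tri (pverts G) (pverts G) ` S_znz G))"
proof -
  interpret pair_graph G by fact
  let ?n = "card (pverts G)"
  let ?T = "tri (pverts G) (pverts G) ` S_znz G"
  note lp = loopings_finite_nonempty[OF pair_finite_verts]
  have "loop_zero_forcing_number H = ?n - tri (pverts G) (pverts G) (pattern_of H)"
    if "H \<in> loopings G" for H
  proof -
    interpret H: pair_pseudo_graph H using looping_pair_pseudo_graph(1)[OF assms that] .
    show ?thesis
      using H.loop_zero_forcing_number_eq looping_pair_pseudo_graph(2)[OF assms that] by simp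
  qed
  then have img: "loop_zero_forcing_number ` loopings G = (\<lambda>t. ?n - t) ` ?T"
    by (auto simp: S_znz_eq_patterns_of_loopings[OF assms] image_image)
  have T: "finite ?T" "?T \<noteq> {}"
    using lp by (simp_all add: S_znz_eq_patterns_of_loopings[OF assms])
  \<comment> \<open>Since \<open>?n - t\<close> decreases in \<open>t\<close>, its maximum is
    attained at the smallest triangle number.\<close>
  have "Zhat G = ?n - Min ?T"
    unfolding Zhat_def img
    by (rule Max_eqI) (use T in \<open>auto intro: diff_le_mono2\<close>)
  moreover have "Min ?T \<le> ?n"
    using Min_in[OF T] tri_le_card[OF pair_finite_verts] by fastforce
  ultimately show ?thesis by simp
qed

end
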